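(* Let $0\le \ell\le k$. A graph $G$ is a $(k,\ell)$-pebble-game graph that is $(k,\ell)$-tight if and only if $G$ is a $(k,\ell)$-maps-and-trees.
   Context: A graph means a finite multigraph, possibly with loops. A graph is $(k,\ell)$-sparse if every subgraph with $n'$ vertices and $m'\ge1$ edges has $m'\le kn'-\ell$. It is $(k,\ell)$-tight if it is $(k,\ell)$-sparse and has exactly $kn-\ell$ edges, where $n$ is its number of vertices. A map-graph is a graph admitting an orientation in which every vertex has out-degree exactly one. A graph $G$ is a $(k,\ell)$-maps-and-trees if its edge set can be partitioned into $\ell$ spanning trees of $G$ and $k-\ell$ spanning subgraphs of $G$ that are map-graphs. The $(k,\ell)$-pebble game with colors is played on a fixed finite vertex set $V$. Its state is a directed multigraph $H$ on $V$ (loops allowed) together with pebbles, each having one of $k$ colors $c_1,\dots,c_k$. Each pebble lies on a vertex or on an edge, and every edge carries exactly one pebble. Initially $H$ has no edges and each vertex carries one pebble of each color. Moves: (add-edge) Let $v,w$ be vertices, not necessarily distinct, whose set $\{v,w\}$ carries at least $\ell+1$ pebbles in total, with $v$ carrying at least one pebble. Pick up a pebble from $v$, add the directed edge $vw$, and put that pebble on it. (pebble-slide) Let $w$ carry a pebble $p$ and let $vw$ be an edge. Replace $vw$ by $wv$, put the pebble from $vw$ onto $v$, and put $p$ on $wv$. $G$ is a $(k,\ell)$-pebble-game graph if it is the underlying undirected graph of some $H$ reachable from the initial configuration on $V(G)$ by finitely many moves. *)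

theory Defs
  imports Complex_Main "HOL-Library.Multiset" "HOL-Library.Disjoint_Sets" "HOL-Library.Uprod"
    "Graph_Theory.Digraph"
begin

text \<open>
  Undirected multigraphs carry edge names, so parallel edges are distinct names with the same
  end pair; a loop at \<open>v\<close> has end pair \<open>Upair v v\<close>.  Values of \<open>mends\<close> outside \<open>medges\<close>
  are irrelevant, so graphs are never compared by record equality.
\<close>

record ('v, 'e) mgraph =
  mverts :: "'v set"
  medges :: "'e set"
  mends :: "'e \<Rightarrow> 'v uprod"

definition multigraph :: "('v, 'e) mgraph \<Rightarrow> bool" where
  "multigraph G \<longleftrightarrow> finite (mverts G) \<and> finite (medges G) \<and>
     (\<forall>e \<in> medges G. set_uprod (mends G e) \<subseteq> mverts G)"

definition msubgraph :: "('v, 'e) mgraph \<Rightarrow> ('v, 'e) mgraph \<Rightarrow> bool" where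
  "msubgraph H G \<longleftrightarrow> multigraph H \<and> mverts H \<subseteq> mverts G \<and> medges H \<subseteq> medges G \<and>
     (\<forall>e \<in> medges H. mends H e = mends G e)"

definition spanning_msubgraph :: "('v, 'e) mgraph \<Rightarrow> ('v, 'e) mgraph \<Rightarrow> bool" where
  "spanning_msubgraph H G \<longleftrightarrow> msubgraph H G \<and> mverts H = mverts G"

text \<open>The bounds are over the integers: \<open>k * n - l\<close> may be negative.\<close>

definition sparse :: "nat \<Rightarrow> nat \<Rightarrow> ('v, 'e) mgraph \<Rightarrow> bool" where
  "sparse k l G \<longleftrightarrow> (\<forall>H. msubgraph H G \<and> card (medges H) \<ge> 1 \<longrightarrow>
     int (card (medges H)) \<le> int k * int (card (mverts H)) - int l)"

definition tight :: "nat \<Rightarrow> nat \<Rightarrow> ('v, 'e) mgraph \<Rightarrow> bool" where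
  "tight k l G \<longleftrightarrow> sparse k l G \<and>
     int (card (medges G)) = int k * int (card (mverts G)) - int l"

text \<open>A walk from \<open>u\<close> to \<open>v\<close> is listed as its steps: the edge used and the vertex it leads to.\<close>

fun mwalk :: "('v, 'e) mgraph \<Rightarrow> 'v \<Rightarrow> ('e \<times> 'v) list \<Rightarrow> 'v \<Rightarrow> bool" where
  "mwalk G u [] v \<longleftrightarrow> u \<in> mverts G \<and> u = v"
| "mwalk G u ((e, w) # p) v \<longleftrightarrow>
     u \<in> mverts G \<and> e \<in> medges G \<and> mends G e = Upair u w \<and> mwalk G w p v"

text \<open>Loops are cycles of length 1 and pairs of parallel edges are cycles of length 2.\<close>

definition mcycle :: "('v, 'e) mgraph \<Rightarrow> 'v \<Rightarrow> ('e \<times> 'v) list \<Rightarrow> bool" where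
  "mcycle G u p \<longleftrightarrow> mwalk G u p u \<and> p \<noteq> [] \<and> distinct (map fst p) \<and> distinct (map snd p)"

definition mconnected :: "('v, 'e) mgraph \<Rightarrow> bool" where
  "mconnected G \<longleftrightarrow> mverts G \<noteq> {} \<and> (\<forall>u \<in> mverts G. \<forall>v \<in> mverts G. \<exists>p. mwalk G u p v)"

definition mtree :: "('v, 'e) mgraph \<Rightarrow> bool" where
  "mtree G \<longleftrightarrow> mconnected G \<and> \<not> (\<exists>u p. mcycle G u p)"

text \<open>Equivalently, \<open>G\<close> is the underlying undirected graph of the digraph \<open>D\<close>.\<close>

definition orientation_of :: "('v, 'e) pre_digraph \<Rightarrow> ('v, 'e) mgraph \<Rightarrow> bool" where
  "orientation_of D G \<longleftrightarrow> verts D = mverts G \<and> arcs D = medges G \<and>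
     (\<forall>e \<in> arcs D. mends G e = Upair (tail D e) (head D e))"

definition map_graph :: "('v, 'e) mgraph \<Rightarrow> bool" where
  "map_graph G \<longleftrightarrow> (\<exists>D. orientation_of D G \<and> (\<forall>v \<in> verts D. out_degree D v = 1))"

text \<open>
  The parts are an indexed family because several of them may have empty edge sets
  (spanning trees of a one-vertex graph).
\<close>

definition maps_and_trees :: "nat \<Rightarrow> nat \<Rightarrow> ('v, 'e) mgraph \<Rightarrow> bool" where
  "maps_and_trees k l G \<longleftrightarrow> (\<exists>S :: nat \<Rightarrow> ('v, 'e) mgraph.
     (\<forall>i < k. spanning_msubgraph (S i) G) \<and>
     disjoint_family_on (\<lambda>i. medges (S i)) {..<k} \<and>
     (\<Union>i<k. medges (S i)) = medges G \<and>
     (\<forall>i < l. mtree (S i)) \<and>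
     (\<forall>i \<in> {l..<k}. map_graph (S i)))"

text \<open>
  Pebbles of equal color are indistinguishable: a vertex carries a multiset of colors, an edge
  carries one color.  The colors are \<open>1, \<dots>, k\<close>.
\<close>

record ('v, 'e) pebble_config =
  digraph_of :: "('v, 'e) pre_digraph"
  on_vertex :: "'v \<Rightarrow> nat multiset"
  on_edge :: "'e \<Rightarrow> nat"

definition initial_config :: "nat \<Rightarrow> 'v set \<Rightarrow> ('v, 'e) pebble_config \<Rightarrow> bool" where
  "initial_config k V C \<longleftrightarrow> verts (digraph_of C) = V \<and> arcs (digraph_of C) = {} \<and>
     (\<forall>v \<in> V. on_vertex C v = mset_set {1..k})"

text \<open>
  In the second rule the edge keeps its name when reversed.  For a loop (\<open>v = w\<close>) that rule
  exchanges the pebble on the loop with \<open>c\<close>; hence the two successive updates of \<open>P\<close>.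
\<close>

inductive pebble_move :: "nat \<Rightarrow> ('v, 'e) pebble_config \<Rightarrow> ('v, 'e) pebble_config \<Rightarrow> bool"
  for l :: nat where
  add_edge:
    "\<lbrakk> v \<in> verts H; w \<in> verts H; e \<notin> arcs H;
       (\<Sum>u\<in>{v, w}. size (P u)) \<ge> l + 1; c \<in># P v \<rbrakk> \<Longrightarrow>
     pebble_move l
       \<lparr> digraph_of = H, on_vertex = P, on_edge = Q \<rparr>
       \<lparr> digraph_of = H\<lparr> arcs := insert e (arcs H),
                         tail := (tail H)(e := v), head := (head H)(e := w) \<rparr>,
         on_vertex = P(v := P v - {#c#}),
         on_edge = Q(e := c) \<rparr>"
| pebble_slide:
    "\<lbrakk> e \<in> arcs H; tail H e = v; head H e = w; c \<in># P w;
       P' = P(w := P w - {#c#}) \<rbrakk> \<Longrightarrow>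
     pebble_move l
       \<lparr> digraph_of = H, on_vertex = P, on_edge = Q \<rparr>
       \<lparr> digraph_of = H\<lparr> tail := (tail H)(e := w), head := (head H)(e := v) \<rparr>,
         on_vertex = P'(v := P' v + {#Q e#}),
         on_edge = Q(e := c) \<rparr>"

definition pebble_game_graph :: "nat \<Rightarrow> nat \<Rightarrow> ('v, 'e) mgraph \<Rightarrow> bool" where
  "pebble_game_graph k l G \<longleftrightarrow> (\<exists>C\<^sub>0 C. initial_config k (mverts G) C\<^sub>0 \<and>
     (pebble_move l)\<^sup>*\<^sup>* C\<^sub>0 C \<and> orientation_of (digraph_of C) G)"

end

theory Submission
  imports Defs
begin

text \<open>
  In every configuration, the pebbles on a vertex together with its out-degree add up to \<open>k\<close>.
  Sliding pebbles along directed paths towards a set \<open>X\<close> until this is no longer possible leaves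
  the set \<open>R\<close> reachable from \<open>X\<close> without outgoing arcs and without pebbles off \<open>X\<close>, so \<open>R\<close> spans
  exactly \<open>k * card R\<close> edges minus the number of pebbles on \<open>X\<close>.

  With \<open>X\<close> the ends of a new edge, sparsity forces \<open>l + 1\<close> pebbles on \<open>X\<close>, so every sparse graph can
  be built by the game.  With \<open>X = {r}\<close> in a tight graph, all \<open>l\<close> free pebbles gather on \<open>r\<close>: the
  out-degrees are \<open>k - l\<close> at \<open>r\<close> and \<open>k\<close> elsewhere.  By sparsity at least \<open>l\<close> arcs then leave every
  nonempty set avoiding \<open>r\<close>, and Edmonds' disjoint branchings theorem provides \<open>l\<close> spanning
  trees oriented towards \<open>r\<close>.  What remains has out-degree \<open>k - l\<close> everywhere and splits
  into \<open>k - l\<close> map-graphs.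
\<close>

subsection \<open>Trees grown by adding leaves\<close>

text \<open>Leaf-by-leaf construction of a tree from the root \<open>r\<close>. For finite graphs it
  agrees with \<open>mtree\<close>, but it provides an induction for edge counts and matches the way
  branchings are grown below.\<close>

inductive grown_tree :: "('e \<Rightarrow> 'v uprod) \<Rightarrow> 'v \<Rightarrow> 'v set \<Rightarrow> 'e set \<Rightarrow> bool"
  for ends :: "'e \<Rightarrow> 'v uprod" and r :: 'v where
  root: "grown_tree ends r {r} {}"
| leaf: "\<lbrakk> grown_tree ends r T F; h \<in> T; v \<notin> T; ends e = Upair v h \<rbrakk> \<Longrightarrow>
     grown_tree ends r (insert v T) (insert e F)"

lemma grown_tree_basic:
  assumes "grown_tree ends r T F"
  shows "finite T \<and> finite F \<and> r \<in> T \<and> (\<forall>e\<in>F. set_uprod (ends e) \<subseteq> T) \<and> Suc (card F) = card T"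
  using assms
proof induction
  case root
  show ?case by simp
next
  case (leaf T F h v e)
  then have "e \<notin> F" by auto
  with leaf show ?case by auto
qed

text \<open>Induction on the last leaf \<open>v\<close>: if both ends of its edge lie in
  \<open>X\<close>, dropping \<open>v\<close> from \<open>X\<close> loses exactly that edge;
  otherwise the new edge is not inside \<open>X\<close>.\<close>

lemma grown_tree_sparse:
  assumes "grown_tree ends r T F" "X \<noteq> {}" "finite X"
  shows "Suc (card {e \<in> F. set_uprod (ends e) \<subseteq> X}) \<le> card X"
  using assms
proof (induction arbitrary: X)
  case root
  then show ?case by (simp add: Suc_leI card_gt_0_iff)
next
  case (leaf T F h v e)
  note basic = grown_tree_basic[OF leaf.hyps(1)]
  have sub: "set_uprod (ends f) \<subseteq> T" if "f \<in> F" for f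
    using basic that by blast
  have e: "e \<notin> F" using sub[of e] leaf.hyps by auto
  show ?case
  proof (cases "v \<in> X \<and> h \<in> X")
    case True
    let ?Y = "X - {v}"
    have "{f \<in> insert e F. set_uprod (ends f) \<subseteq> X} = insert e {f \<in> F. set_uprod (ends f) \<subseteq> ?Y}"
      using True leaf.hyps sub by fastforce
    moreover have "Suc (card {f \<in> F. set_uprod (ends f) \<subseteq> ?Y}) \<le> card ?Y"
      using True leaf.hyps leaf.prems by (intro leaf.IH) auto
    ultimately show ?thesis
      using e basic True leaf.prems by (simp add: card_Diff_singleton)
  next
    case False
    then have "{f \<in> insert e F. set_uprod (ends f) \<subseteq> X} = {f \<in> F. set_uprod (ends f) \<subseteq> X}"
      using leaf.hyps by auto
    then show ?thesis using leaf.IH[OF leaf.prems] by simp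
  qed
qed

section \<open>Walks, paths and cycles in grown trees\<close>

lemma mwalk_mono:
  assumes "mwalk G u p v" "mverts G \<subseteq> mverts G'" "medges G \<subseteq> medges G'"
    "\<And>e. e \<in> medges G \<Longrightarrow> mends G' e = mends G e"
  shows "mwalk G' u p v"
  using assms by (induction G u p v rule: mwalk.induct) auto

lemma mwalk_subset:
  assumes "mwalk G u p v"
  shows "fst ` set p \<subseteq> medges G \<and> snd ` set p \<subseteq> mverts G \<and> u \<in> mverts G \<and> v \<in> mverts G"
  using assms by (induction G u p v rule: mwalk.induct) auto

lemma mwalk_snoc:
  "mwalk G u (p @ [(e, w)]) v \<longleftrightarrow>
     w = v \<and> v \<in> mverts G \<and> e \<in> medges G \<and> (\<exists>x. mwalk G u p x \<and> mends G e = Upair x w)"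
proof (induction p arbitrary: u)
  case Nil
  then show ?case by auto
next
  case (Cons a p)
  then show ?case by (cases a) auto
qed

lemma mwalk_enters:
  assumes "mwalk G u p v" "u \<notin> T" "v \<in> T"
  shows "\<exists>e x y. e \<in> medges G \<and> x \<in> mverts G - T \<and> y \<in> T \<and> mends G e = Upair x y"
  using assms by (induction G u p v rule: mwalk.induct) auto

abbreviation mgraph_on :: "('e \<Rightarrow> 'v uprod) \<Rightarrow> 'v set \<Rightarrow> 'e set \<Rightarrow> ('v, 'e) mgraph" where
  "mgraph_on ends T F \<equiv> \<lparr> mverts = T, medges = F, mends = ends \<rparr>"

lemma grown_tree_path:
  assumes "grown_tree ends r T F" "a \<in> T" "b \<in> T"
  shows "\<exists>p. mwalk (mgraph_on ends T F) a p b \<and> distinct (map fst p) \<and> distinct (a # map snd p)"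
  using assms
proof (induction arbitrary: a b)
  case root
  then show ?case by (intro exI[of _ "[]"]) simp
next
  case (leaf T F h v e)
  let ?G = "mgraph_on ends T F" and ?G' = "mgraph_on ends (insert v T) (insert e F)"
  have e: "e \<notin> F" using grown_tree_basic[OF leaf.hyps(1)] leaf.hyps by auto
  have mono: "mwalk ?G' x p y" if "mwalk ?G x p y" for x p y
    by (rule mwalk_mono[OF that]) auto
  show ?case
  proof (cases "a = v"; cases "b = v")
    assume "a = v" "b = v"
    then show ?thesis by (intro exI[of _ "[]"]) simp
  next
    assume ab: "a = v" "b \<noteq> v"
    then obtain p where p: "mwalk ?G h p b" "distinct (map fst p)" "distinct (h # map snd p)"
      using leaf.IH[of h b] leaf.hyps leaf.prems by auto
    have "mwalk ?G' a ((e, h) # p) b"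
      using mono[OF p(1)] ab leaf.hyps by simp
    moreover have "distinct (map fst ((e, h) # p))" "distinct (a # map snd ((e, h) # p))"
      using mwalk_subset[OF p(1)] p e ab leaf.hyps by auto
    ultimately show ?thesis by blast
  next
    assume ab: "a \<noteq> v" "b = v"
    then obtain p where p: "mwalk ?G a p h" "distinct (map fst p)" "distinct (a # map snd p)"
      using leaf.IH[of a h] leaf.hyps leaf.prems by auto
    have "mwalk ?G' a (p @ [(e, v)]) b"
      using mono[OF p(1)] ab leaf.hyps by (auto simp: mwalk_snoc)
    moreover have "distinct (map fst (p @ [(e, v)]))" "distinct (a # map snd (p @ [(e, v)]))"
      using mwalk_subset[OF p(1)] p e ab leaf.hyps by auto
    ultimately show ?thesis by blast
  next
    assume "a \<noteq> v" "b \<noteq> v"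
    then show ?thesis using leaf.IH[of a b] leaf.prems mono by blast
  qed
qed

text \<open>The only edge at \<open>v\<close> is \<open>e\<close>, so a walk that enters
  \<open>v\<close> has to leave it along \<open>e\<close> again and repeats an edge.\<close>

lemma mwalk_avoids_leaf:
  assumes "mwalk (mgraph_on ends (insert v T) (insert e F)) a p b"
    and "a \<noteq> v" "b \<noteq> v" "distinct (map fst p)"
    and "\<forall>f\<in>F. v \<notin> set_uprod (ends f)" "v \<in> set_uprod (ends e)"
  shows "mwalk (mgraph_on ends T F) a p b"
  using assms(1-4)
proof (induction p arbitrary: a)
  case Nil
  then show ?case by auto
next
  case (Cons s p)
  obtain f w where s: "s = (f, w)" by fastforce
  have f: "f \<in> insert e F" "ends f = Upair a w"
    and walk: "mwalk (mgraph_on ends (insert v T) (insert e F)) w p b"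
    using Cons.prems s by auto
  have "w \<noteq> v"
  proof
    assume "w = v"
    then obtain f' w' p' where p: "p = (f', w') # p'"
      using walk Cons.prems(3) by (cases p) auto
    then have "f' \<in> insert e F" "ends f' = Upair v w'" using walk \<open>w = v\<close> by auto
    then have "f' = e" "f = e" using f \<open>w = v\<close> assms(5) by auto
    then show False using Cons.prems(4) s p by simp
  qed
  moreover have "f \<noteq> e" using f(2) assms(6) \<open>w \<noteq> v\<close> Cons.prems(2) by auto
  ultimately show ?case using Cons f s walk by auto
qed

lemma grown_tree_acyclic:
  assumes "grown_tree ends r T F"
  shows "\<not> mcycle (mgraph_on ends T F) u p"
  using assms
proof induction
  case root
  show ?case by (cases p) (auto simp: mcycle_def)
next
  case (leaf T F h v e)
  have F: "\<forall>f\<in>F. v \<notin> set_uprod (ends f)"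
    using grown_tree_basic[OF leaf.hyps(1)] leaf.hyps by blast
  show ?case
  proof
    assume cyc: "mcycle (mgraph_on ends (insert v T) (insert e F)) u p"
    show False
    proof (cases "u = v")
      case False
      then have "mcycle (mgraph_on ends T F) u p"
        using cyc mwalk_avoids_leaf[of v T e F ends u p u] F leaf.hyps
        unfolding mcycle_def by auto
      then show False using leaf.IH by simp
    next
      \<comment> \<open>A cycle based at the leaf starts and ends with \<open>e\<close>. Since
        \<open>e\<close> is not a loop, the cycle has at least two steps, so \<open>e\<close> is
        repeated.\<close>
      case True
      obtain f w q where p: "p = (f, w) # q"
        using cyc unfolding mcycle_def by (cases p) auto
      then have f: "f \<in> insert e F" "ends f = Upair v w"
        and q: "mwalk (mgraph_on ends (insert v T) (insert e F)) w q v"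
        using cyc True unfolding mcycle_def by auto
      have "f = e" using f F by auto
      then have "w \<noteq> v" using f leaf.hyps by auto
      then obtain q' g where q': "q = q' @ [g]"
        using q by (cases q rule: rev_cases) auto
      obtain f' w' where g: "g = (f', w')" by fastforce
      then have "f' \<in> insert e F" "v \<in> set_uprod (ends f')"
        using q q' by (auto simp: mwalk_snoc)
      then have "f' = e" using F by auto
      then show False using cyc p q' g \<open>f = e\<close> unfolding mcycle_def by simp
    qed
  qed
qed

lemma grown_tree_mtree:
  assumes "grown_tree ends r T F"
  shows "mtree (mgraph_on ends T F)"
  unfolding mtree_def mconnected_def mgraph.simps
proof (intro conjI ballI notI)
  show "T = {} \<Longrightarrow> False" using grown_tree_basic[OF assms] by blast
  show "\<exists>p. mwalk (mgraph_on ends T F) u p v" if "u \<in> T" "v \<in> T" for u v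
    using grown_tree_path[OF assms that] by blast
  show "\<exists>u p. mcycle (mgraph_on ends T F) u p \<Longrightarrow> False"
    using grown_tree_acyclic[OF assms] by blast
qed

text \<open>A grown tree inside \<open>G\<close> with as many vertices as possible reaches every
  vertex by connectedness and, by acyclicity, omits no edge.\<close>

lemma mtree_grown_tree:
  assumes "multigraph G" "mtree G"
  shows "\<exists>r. grown_tree (mends G) r (mverts G) (medges G)"
proof -
  obtain r where r: "r \<in> mverts G"
    using assms unfolding mtree_def mconnected_def by auto
  define P where "P T \<longleftrightarrow>
    (\<exists>F. grown_tree (mends G) r T F \<and> T \<subseteq> mverts G \<and> F \<subseteq> medges G)" for T
  have "P {r}" using r grown_tree.root[of "mends G" r] unfolding P_def by blast
  moreover have "\<forall>T. P T \<longrightarrow> card T < Suc (card (mverts G))"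
    using assms(1) by (auto simp: P_def multigraph_def less_Suc_eq_le intro: card_mono)
  ultimately have "\<exists>T. P T \<and> (\<forall>T'. P T' \<longrightarrow> card T' \<le> card T)"
    by (rule ex_has_greatest_nat)
  then obtain T where "P T" and T_max: "\<forall>T'. P T' \<longrightarrow> card T' \<le> card T"
    by blast
  then obtain F where gt: "grown_tree (mends G) r T F" and "T \<subseteq> mverts G" "F \<subseteq> medges G"
    unfolding P_def by blast
  note basic = grown_tree_basic[OF gt]
  have "T = mverts G"
  proof (rule ccontr)
    assume "T \<noteq> mverts G"
    then obtain u where "u \<in> mverts G" "u \<notin> T" using \<open>T \<subseteq> mverts G\<close> by blast
    moreover obtain p where "mwalk G u p r"
      using assms r \<open>u \<in> mverts G\<close> unfolding mtree_def mconnected_def by blast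
    \<comment> \<open>The walk from \<open>u\<close> to the root has to enter \<open>T\<close>, and
      the edge on which it does so could be added as a leaf.\<close>
    ultimately obtain e x y where e: "e \<in> medges G" "x \<in> mverts G - T" "y \<in> T" "mends G e = Upair x y"
      using mwalk_enters[of G u p r T] basic by blast
    then have "grown_tree (mends G) r (insert x T) (insert e F)"
      by (intro grown_tree.leaf[OF gt, of y]) auto
    then have "P (insert x T)"
      unfolding P_def using e \<open>T \<subseteq> mverts G\<close> \<open>F \<subseteq> medges G\<close> by blast
    then have "card (insert x T) \<le> card T" using T_max by blast
    then show False using e basic by simp
  qed
  moreover have "F = medges G"
  proof (rule ccontr)
    assume "F \<noteq> medges G"
    then obtain e where e: "e \<in> medges G" "e \<notin> F" using \<open>F \<subseteq> medges G\<close> by blast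
    obtain a b where ab: "mends G e = Upair a b" by (cases "mends G e") auto
    then have "a \<in> T" "b \<in> T"
      using e assms(1) \<open>T = mverts G\<close> unfolding multigraph_def by force+
    \<comment> \<open>The tree path between the ends of \<open>e\<close> is closed to a cycle by
      \<open>e\<close>; the path is empty when \<open>e\<close> is a loop.\<close>
    then obtain p where p: "mwalk (mgraph_on (mends G) T F) b p a" "distinct (map fst p)"
        "distinct (b # map snd p)"
      using grown_tree_path[OF gt] by blast
    have "mwalk G b p a"
      using \<open>T \<subseteq> mverts G\<close> \<open>F \<subseteq> medges G\<close> by (intro mwalk_mono[OF p(1)]) auto
    then have "mwalk G b (p @ [(e, b)]) b"
      using e ab \<open>b \<in> T\<close> \<open>T \<subseteq> mverts G\<close> by (auto simp: mwalk_snoc)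
    then have "mcycle G b (p @ [(e, b)])"
      using p mwalk_subset[OF p(1)] e unfolding mcycle_def by auto
    then show False using assms(2) unfolding mtree_def by blast
  qed
  ultimately show ?thesis using gt by blast
qed

lemma mtree_card:
  assumes "multigraph G" "mtree G"
  shows "int (card (medges G)) = int (card (mverts G)) - 1"
proof -
  obtain r where "grown_tree (mends G) r (mverts G) (medges G)"
    using mtree_grown_tree[OF assms] by blast
  then show ?thesis using grown_tree_basic by fastforce
qed

lemma mtree_induced_card:
  assumes "multigraph G" "mtree G" "finite X" "X \<noteq> {}"
  shows "int (card {e \<in> medges G. set_uprod (mends G e) \<subseteq> X}) \<le> int (card X) - 1"
proof -
  obtain r where "grown_tree (mends G) r (mverts G) (medges G)"
    using mtree_grown_tree[OF assms(1,2)] by blast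
  then show ?thesis using grown_tree_sparse[OF _ assms(4,3)] by fastforce
qed

subsection \<open>Counting edges of maps-and-trees\<close>

text \<open>The bijection is the tail map of the orientation: out-degree one means that every vertex
  is the tail of exactly one edge.\<close>

lemma map_graph_bij:
  assumes "map_graph G" "multigraph G"
  obtains t where "bij_betw t (medges G) (mverts G)" "\<forall>e\<in>medges G. t e \<in> set_uprod (mends G e)"
proof -
  obtain D where D: "orientation_of D G" "\<forall>v\<in>verts D. out_degree D v = 1"
    using assms unfolding map_graph_def by blast
  have ends: "\<forall>e\<in>medges G. tail D e \<in> set_uprod (mends G e)"
    using D(1) unfolding orientation_of_def by auto
  have "\<exists>!e. e \<in> medges G \<and> tail D e = v" if "v \<in> mverts G" for v
  proof -
    have "card {e \<in> medges G. tail D e = v} = 1"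
      using D that unfolding orientation_of_def out_degree_def out_arcs_def by auto
    then obtain e where "{e \<in> medges G. tail D e = v} = {e}"
      using card_1_singletonE by blast
    then show ?thesis by (intro ex1I[of _ e]) auto
  qed
  moreover have "tail D e \<in> mverts G" if "e \<in> medges G" for e
    using that ends assms(2) unfolding multigraph_def by blast
  ultimately have "bij_betw (tail D) (medges G) (mverts G)"
    unfolding bij_betw_def inj_on_def by blast
  then show ?thesis using ends that by blast
qed

lemma map_graph_induced_card:
  assumes "map_graph G" "multigraph G" "finite X"
  shows "card {e \<in> medges G. set_uprod (mends G e) \<subseteq> X} \<le> card X"
proof -
  obtain t where t: "bij_betw t (medges G) (mverts G)" "\<forall>e\<in>medges G. t e \<in> set_uprod (mends G e)"
    using map_graph_bij[OF assms(1,2)] .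
  show ?thesis
  proof (rule card_inj_on_le[of t])
    show "inj_on t {e \<in> medges G. set_uprod (mends G e) \<subseteq> X}"
      using t(1) by (auto simp: bij_betw_def inj_on_def)
    show "t ` {e \<in> medges G. set_uprod (mends G e) \<subseteq> X} \<subseteq> X" using t(2) by auto
  qed fact
qed

text \<open>On \<open>n\<close> vertices a tree has \<open>n - 1\<close> edges and a map-graph has
  \<open>n\<close>, which sum to \<open>k * n - l\<close> over the parts. Inside a nonempty vertex
  set the same numbers are upper bounds for each part, and this gives sparsity.\<close>

lemma maps_and_trees_tight:
  fixes G :: "('v, 'e) mgraph"
  assumes G: "multigraph G" and "l \<le> k" and "maps_and_trees k l G"
  shows "tight k l G"
proof -
  obtain S :: "nat \<Rightarrow> ('v, 'e) mgraph" where
    span: "\<forall>i<k. spanning_msubgraph (S i) G" and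
    disj: "disjoint_family_on (\<lambda>i. medges (S i)) {..<k}" and
    un: "(\<Union>i<k. medges (S i)) = medges G" and
    trees': "\<forall>i<l. mtree (S i)" and maps': "\<forall>i\<in>{l..<k}. map_graph (S i)"
    using assms(3) unfolding maps_and_trees_def by auto
  have trees: "mtree (S i)" if "i < l" for i using trees' that by blast
  have maps: "map_graph (S i)" if "l \<le> i" "i < k" for i using maps' that by auto
  have mg: "multigraph (S i)" and verts: "mverts (S i) = mverts G"
    and ends: "\<forall>e\<in>medges (S i). mends (S i) e = mends G e" if "i < k" for i
    using span that unfolding spanning_msubgraph_def msubgraph_def by auto
  have fin: "finite (medges (S i))" if "i < k" for i
    using mg[OF that] unfolding multigraph_def by blast
  have split: "int (card E) = (\<Sum>i<k. int (card (E \<inter> medges (S i))))" if "E \<subseteq> medges G" for E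
  proof -
    have "card (\<Union>i\<in>{..<k}. E \<inter> medges (S i)) = (\<Sum>i<k. card (E \<inter> medges (S i)))"
      using fin disj by (intro card_UN_disjoint) (auto simp: disjoint_family_on_def)
    moreover have "(\<Union>i\<in>{..<k}. E \<inter> medges (S i)) = E" using that un by auto
    ultimately show ?thesis by simp
  qed
  have total: "(\<Sum>i<k. n - (if i < l then 1 else 0)) = int k * n - int l" for n :: int
  proof -
    have "{i. i < k \<and> i < l} = {..<l}" using \<open>l \<le> k\<close> by auto
    then have "(\<Sum>i<k. (if i < l then 1 else 0) :: int) = int l"
      by (simp add: sum.If_cases Int_def)
    then show ?thesis by (simp add: sum_subtractf)
  qed
  have "int (card (medges G)) = (\<Sum>i<k. int (card (mverts G)) - (if i < l then 1 else 0))"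
    unfolding split[OF subset_refl]
  proof (rule sum.cong)
    fix i assume "i \<in> {..<k}"
    then have i: "i < k" by simp
    have "medges G \<inter> medges (S i) = medges (S i)" using un i by auto
    moreover have "int (card (medges (S i))) = int (card (mverts G)) - (if i < l then 1 else 0)"
    proof (cases "i < l")
      case True
      then show ?thesis using mtree_card[OF mg[OF i] trees] verts[OF i] by simp
    next
      case False
      then obtain t where "bij_betw t (medges (S i)) (mverts (S i))"
        using map_graph_bij[OF maps mg] i by (metis not_less)
      then show ?thesis using False verts[OF i] bij_betw_same_card by fastforce
    qed
    ultimately show "int (card (medges G \<inter> medges (S i))) =
        int (card (mverts G)) - (if i < l then 1 else 0)" by simp
  qed simp
  moreover have "int (card (medges H)) \<le> int k * int (card (mverts H)) - int l"
    if H: "msubgraph H G" "card (medges H) \<ge> 1" for H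
  proof -
    have H': "multigraph H" "medges H \<subseteq> medges G" "\<forall>e\<in>medges H. mends H e = mends G e"
      using H unfolding msubgraph_def by auto
    then have finV: "finite (mverts H)" unfolding multigraph_def by blast
    \<comment> \<open>An edge of \<open>H\<close> makes \<open>mverts H\<close> nonempty; for the
      empty set the tree bound \<open>card X - 1\<close> would be negative.\<close>
    obtain e where e: "e \<in> medges H" using H(2) by fastforce
    then have "set_uprod (mends H e) \<subseteq> mverts H" using H'(1) unfolding multigraph_def by blast
    moreover have "set_uprod (mends H e) \<noteq> {}" by (cases "mends H e") auto
    ultimately have ne: "mverts H \<noteq> {}" by auto
    have "int (card (medges H \<inter> medges (S i))) \<le> int (card (mverts H)) - (if i < l then 1 else 0)"
      if i: "i < k" for i
    proof -
      let ?I = "{e \<in> medges (S i). set_uprod (mends (S i) e) \<subseteq> mverts H}"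
      have "medges H \<inter> medges (S i) \<subseteq> ?I"
        using H' ends[OF i] unfolding multigraph_def by (auto dest!: bspec)
      then have "card (medges H \<inter> medges (S i)) \<le> card ?I"
        using fin[OF i] by (intro card_mono) auto
      moreover have "int (card ?I) \<le> int (card (mverts H)) - (if i < l then 1 else 0)"
        using mtree_induced_card[OF mg[OF i] trees finV ne]
          map_graph_induced_card[OF maps mg[OF i] finV] i by auto
      ultimately show ?thesis by linarith
    qed
    then have "int (card (medges H)) \<le> (\<Sum>i<k. int (card (mverts H)) - (if i < l then 1 else 0))"
      unfolding split[OF H'(2)] by (intro sum_mono) auto
    then show ?thesis by (simp add: total)
  qed
  ultimately show ?thesis unfolding tight_def sparse_def by (simp add: total)
qed

subsection \<open>Collecting pebbles\<close>

text \<open>The invariant of the game, blind to colors. Finiteness of the arc set keeps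
  \<open>out_degree\<close> from being the default cardinality 0 of an infinite set.\<close>

definition pebbled :: "nat \<Rightarrow> 'v set \<Rightarrow> ('v, 'e) pebble_config \<Rightarrow> bool" where
  "pebbled k V C \<longleftrightarrow> verts (digraph_of C) = V \<and> finite (arcs (digraph_of C)) \<and>
     (\<forall>v\<in>V. size (on_vertex C v) + out_degree (digraph_of C) v = k)"

lemma card_fibre_remove:
  assumes "finite A" "e \<in> A"
  shows "card {f \<in> A. t f = x} = card ({f \<in> A. t f = x} - {e}) + (if t e = x then 1 else 0)"
proof -
  have "card {f \<in> A. t f = x} > 0" if "t e = x"
    using that assms by (auto simp: card_gt_0_iff)
  then show ?thesis using assms by (auto simp: card_Diff_singleton_if)
qed

text \<open>One unit moves from the fibre of the old value to the fibre of \<open>w\<close>. The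
  additive form avoids truncated subtraction and covers \<open>t e = w\<close>, which occurs when a
  loop is reversed.\<close>

lemma card_fibre_update:
  assumes "finite A" "e \<in> A"
  shows "card {f \<in> A. (t(e := w)) f = x} + (if t e = x then 1 else 0) =
    card {f \<in> A. t f = x} + (if w = x then 1 else 0)"
proof -
  have "{f \<in> A. (t(e := w)) f = x} - {e} = {f \<in> A. t f = x} - {e}" by auto
  then show ?thesis
    using card_fibre_remove[OF assms, of t x] card_fibre_remove[OF assms, of "t(e := w)" x] by simp
qed

text \<open>Mirror image of \<open>card_fibre_update\<close>: a slide moves the tail of its arc from
  \<open>v\<close> to \<open>w\<close> and one pebble from \<open>w\<close> to \<open>v\<close>, so
  the two changes cancel in the invariant.\<close>

lemma size_slide:
  assumes "c \<in># P w" "P' = P(w := P w - {#c#})"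
  shows "size ((P'(v := P' v + {#q#})) x) + (if w = x then 1 else 0) =
    size (P x) + (if v = x then 1 else 0)"
proof -
  have "size (P w) > 0" using assms(1) by (auto simp: nonempty_has_size[symmetric])
  then show ?thesis using assms by (auto simp: size_Diff_singleton)
qed

lemma pebble_move_pebbled:
  assumes "pebble_move l C C'" "pebbled k V C"
  shows "pebbled k V C'"
  using assms
proof cases
  case (add_edge v H w e P c Q)
  have "size (P v) > 0" using add_edge by (auto simp: nonempty_has_size[symmetric])
  moreover have "{f \<in> insert e (arcs H). ((tail H)(e := v)) f = x} =
      (if x = v then insert e {f \<in> arcs H. tail H f = x} else {f \<in> arcs H. tail H f = x})" for x
    using \<open>e \<notin> arcs H\<close> by auto
  ultimately show ?thesis
    using assms(2) add_edge
    unfolding pebbled_def out_degree_def out_arcs_def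
    by (auto simp: size_Diff_singleton)
next
  case (pebble_slide e H v w c P P' Q)
  have fin: "finite (arcs H)" using assms(2) pebble_slide unfolding pebbled_def by simp
  have "size ((P'(v := P' v + {#Q e#})) x) + card {f \<in> arcs H. ((tail H)(e := w)) f = x} =
      size (P x) + card {f \<in> arcs H. tail H f = x}" for x
    using size_slide[of c P w P' v "Q e" x] card_fibre_update[OF fin, of e "tail H" w x] pebble_slide
    by simp
  then show ?thesis
    using assms(2) pebble_slide(1,2) unfolding pebbled_def out_degree_def out_arcs_def by simp
qed

lemma reachable_pebbled:
  assumes "(pebble_move l)\<^sup>*\<^sup>* C C'" "pebbled k V C"
  shows "pebbled k V C'"
  using assms by induction (auto intro: pebble_move_pebbled)

lemma initial_pebbled: "initial_config k V C \<Longrightarrow> pebbled k V C"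
  unfolding initial_config_def pebbled_def by (simp add: out_degree_def out_arcs_def)

text \<open>Directed paths from \<open>X\<close> to \<open>x\<close>, with their arcs listed backwards from \<open>x\<close>, which is the
  order in which a pebble slides towards \<open>X\<close>.\<close>

fun back_path :: "('v, 'e) pre_digraph \<Rightarrow> 'v set \<Rightarrow> 'e list \<Rightarrow> 'v \<Rightarrow> bool" where
  "back_path D X [] x \<longleftrightarrow> x \<in> X"
| "back_path D X (e # es) x \<longleftrightarrow> e \<in> arcs D \<and> head D e = x \<and> back_path D X es (tail D e)"

lemma back_path_suffix:
  assumes "back_path D X (p @ e # q) x"
  shows "back_path D X (e # q) (head D e)"
  using assms by (induction p arbitrary: x) auto

lemma back_path_cong:
  assumes "back_path D X p x" "arcs D' = arcs D"
    "\<And>e. e \<in> set p \<Longrightarrow> tail D' e = tail D e \<and> head D' e = head D e"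
  shows "back_path D' X p x"
  using assms by (induction p arbitrary: x) auto

text \<open>The arcs are required to be distinct because a slide reverses its arc, which must then
  not occur on the rest of the path. Repeated vertices are harmless.\<close>

definition reach :: "('v, 'e) pre_digraph \<Rightarrow> 'v set \<Rightarrow> 'v set" where
  "reach D X = {x. \<exists>p. back_path D X p x \<and> distinct p}"

lemma reach_superset: "X \<subseteq> reach D X"
  unfolding reach_def by (auto intro: exI[of _ "[]"])

lemma reach_closed:
  assumes "e \<in> arcs D" "tail D e \<in> reach D X"
  shows "head D e \<in> reach D X"
proof -
  obtain p where p: "back_path D X p (tail D e)" "distinct p"
    using assms(2) unfolding reach_def by blast
  show ?thesis
  proof (cases "e \<in> set p")
    \<comment> \<open>If \<open>e\<close> already occurs on \<open>p\<close>, the part of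
      \<open>p\<close> from \<open>e\<close> back to \<open>X\<close> is itself a path to the head
      of \<open>e\<close>.\<close>
    case True
    then obtain a b where "p = a @ e # b" by (auto simp: in_set_conv_decomp)
    then have "back_path D X (e # b) (head D e)" "distinct (e # b)"
      using p back_path_suffix[of D X a e b] by auto
    then show ?thesis unfolding reach_def by blast
  next
    case False
    then have "back_path D X (e # p) (head D e)" "distinct (e # p)" using p assms by auto
    then show ?thesis unfolding reach_def by blast
  qed
qed

lemma reach_subset:
  assumes "X \<subseteq> V" "\<And>e. e \<in> arcs D \<Longrightarrow> head D e \<in> V"
  shows "reach D X \<subseteq> V"
proof
  fix x assume "x \<in> reach D X"
  then obtain p where "back_path D X p x" unfolding reach_def by blast
  then show "x \<in> V" using assms by (cases p) auto
qed

lemma slide: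
  assumes "e \<in> arcs (digraph_of C)" "on_vertex C (head (digraph_of C) e) \<noteq> {#}"
    and "orientation_of (digraph_of C) G"
  obtains C' where "pebble_move l C C'" "orientation_of (digraph_of C') G"
    "\<And>f. f \<noteq> e \<Longrightarrow> tail (digraph_of C') f = tail (digraph_of C) f \<and>
       head (digraph_of C') f = head (digraph_of C) f"
    "\<And>x. size (on_vertex C' x) + (if head (digraph_of C) e = x then 1 else 0) =
       size (on_vertex C x) + (if tail (digraph_of C) e = x then 1 else 0)"
proof -
  obtain H P Q where C: "C = \<lparr> digraph_of = H, on_vertex = P, on_edge = Q \<rparr>"
    by (cases C) auto
  obtain c where c: "c \<in># P (head H e)" using assms(2) C by (auto simp: multiset_nonemptyE)
  define P' where "P' = P(head H e := P (head H e) - {#c#})"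
  define C' where "C' = \<lparr> digraph_of = H\<lparr> tail := (tail H)(e := head H e),
      head := (head H)(e := tail H e) \<rparr>,
    on_vertex = P'(tail H e := P' (tail H e) + {#Q e#}), on_edge = Q(e := c) \<rparr>"
  show ?thesis
  proof
    show "pebble_move l C C'"
      unfolding C C'_def using assms(1) c C P'_def by (intro pebble_slide) auto
    show "orientation_of (digraph_of C') G"
      using assms(1,3) unfolding C C'_def orientation_of_def by (auto simp: insert_commute)
    show "tail (digraph_of C') f = tail (digraph_of C) f \<and>
       head (digraph_of C') f = head (digraph_of C) f" if "f \<noteq> e" for f
      using that unfolding C C'_def by simp
    show "size (on_vertex C' x) + (if head (digraph_of C) e = x then 1 else 0) =
       size (on_vertex C x) + (if tail (digraph_of C) e = x then 1 else 0)" for x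
      using size_slide[OF c P'_def] unfolding C C'_def by simp
  qed
qed

abbreviation pebbles :: "('v, 'e) pebble_config \<Rightarrow> 'v set \<Rightarrow> nat" where
  "pebbles C X \<equiv> (\<Sum>x\<in>X. size (on_vertex C x))"

text \<open>The pebble moves arc by arc from \<open>x\<close> back along the path and stops at the
  first vertex of \<open>X\<close> it meets. Until then it stays outside \<open>X\<close>, so the
  count on \<open>X\<close> changes only on arrival.\<close>

lemma slide_along_path:
  assumes "back_path (digraph_of C) X p x" "distinct p" "x \<notin> X" "on_vertex C x \<noteq> {#}"
    and "orientation_of (digraph_of C) G" "finite X"
  shows "\<exists>C'. (pebble_move l)\<^sup>*\<^sup>* C C' \<and> orientation_of (digraph_of C') G \<and>
    pebbles C X < pebbles C' X"
  using assms
proof (induction p arbitrary: C x)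
  case Nil
  then show ?case by simp
next
  case (Cons e p)
  let ?D = "digraph_of C"
  let ?y = "tail ?D e"
  have e: "e \<in> arcs ?D" "head ?D e = x" and p: "back_path ?D X p ?y" "e \<notin> set p"
    using Cons.prems by auto
  obtain C' where C': "pebble_move l C C'" "orientation_of (digraph_of C') G"
    "\<And>f. f \<noteq> e \<Longrightarrow> tail (digraph_of C') f = tail ?D f \<and> head (digraph_of C') f = head ?D f"
    and sz: "\<And>z. size (on_vertex C' z) + (if x = z then 1 else 0) =
       size (on_vertex C z) + (if ?y = z then 1 else 0)"
    using slide[of e C G l] e Cons.prems by metis
  have sum: "pebbles C' X = pebbles C X + (if ?y \<in> X then 1 else 0)"
  proof -
    have "pebbles C' X = (\<Sum>z\<in>X. size (on_vertex C z) + (if ?y = z then 1 else 0))"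
    proof (rule sum.cong)
      show "size (on_vertex C' z) = size (on_vertex C z) + (if ?y = z then 1 else 0)" if "z \<in> X" for z
        using sz[of z] that Cons.prems(3) by (cases "x = z") auto
    qed simp
    then show ?thesis using Cons.prems(6) by (simp add: sum.distrib)
  qed
  show ?case
  proof (cases "?y \<in> X")
    case True
    then show ?thesis using C'(1,2) sum by auto
  next
    case False
    \<comment> \<open>If \<open>e\<close> is a loop, then \<open>?y = x\<close> and the slide leaves
      its count unchanged, so the pebble needed for the next slide is the one already there.\<close>
    have "?y \<noteq> x \<or> on_vertex C ?y \<noteq> {#}" using Cons.prems(4) by auto
    then have "on_vertex C' ?y \<noteq> {#}"
      using sz[of ?y] by (auto split: if_splits)
    \<comment> \<open>Only \<open>e\<close> has been reversed, and \<open>e\<close> does not occur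
      on \<open>p\<close>.\<close>
    moreover have "back_path (digraph_of C') X p ?y"
    proof (rule back_path_cong[OF p(1)])
      show "arcs (digraph_of C') = arcs ?D"
        using C'(2) Cons.prems(5) by (simp add: orientation_of_def)
      show "tail (digraph_of C') f = tail ?D f \<and> head (digraph_of C') f = head ?D f"
        if "f \<in> set p" for f
        using that p(2) by (intro C'(3)) auto
    qed
    ultimately obtain C'' where "(pebble_move l)\<^sup>*\<^sup>* C' C''" "orientation_of (digraph_of C'') G"
        "pebbles C' X < pebbles C'' X"
      using Cons.IH[of C' ?y] Cons.prems False C'(2) by auto
    moreover have "(pebble_move l)\<^sup>*\<^sup>* C C''"
      using C'(1) \<open>(pebble_move l)\<^sup>*\<^sup>* C' C''\<close> by (rule converse_rtranclp_into_rtranclp)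
    moreover have "pebbles C' X = pebbles C X" using sum False by simp
    ultimately show ?thesis by auto
  qed
qed

lemma pebbles_le:
  assumes "pebbled k V C" "X \<subseteq> V"
  shows "pebbles C X \<le> card X * k"
  using assms sum_bounded_above[of X "\<lambda>x. size (on_vertex C x)" k]
  unfolding pebbled_def by fastforce

text \<open>Among the reachable configurations, take one with the most pebbles on \<open>X\<close>;
  a maximum exists since every vertex carries at most \<open>k\<close>. A pebble on a reachable
  vertex off \<open>X\<close> could still be slid into \<open>X\<close>.\<close>

lemma collect_pebbles:
  assumes "pebbled k V C" "orientation_of (digraph_of C) G" "X \<subseteq> V" "finite V"
  obtains C' where "(pebble_move l)\<^sup>*\<^sup>* C C'" "orientation_of (digraph_of C') G" "pebbled k V C'"
    "\<And>x. x \<in> reach (digraph_of C') X - X \<Longrightarrow> on_vertex C' x = {#}"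
proof -
  let ?P = "\<lambda>C'. (pebble_move l)\<^sup>*\<^sup>* C C' \<and> orientation_of (digraph_of C') G"
  have peb: "pebbled k V C'" if "?P C'" for C' using reachable_pebbled that assms(1) by blast
  have "?P C" using assms by simp
  moreover have "\<forall>C'. ?P C' \<longrightarrow> pebbles C' X < Suc (card X * k)"
    using pebbles_le[OF peb assms(3)] by (simp add: less_Suc_eq_le)
  ultimately have "\<exists>C'. ?P C' \<and> (\<forall>C''. ?P C'' \<longrightarrow> pebbles C'' X \<le> pebbles C' X)"
    by (rule ex_has_greatest_nat)
  then obtain C' where C': "?P C'" and max: "\<forall>C''. ?P C'' \<longrightarrow> pebbles C'' X \<le> pebbles C' X"
    by blast
  have "on_vertex C' x = {#}" if "x \<in> reach (digraph_of C') X - X" for x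
  proof (rule ccontr)
    assume ne: "on_vertex C' x \<noteq> {#}"
    obtain p where "back_path (digraph_of C') X p x" "distinct p"
      using \<open>x \<in> _\<close> unfolding reach_def by blast
    moreover have "x \<notin> X" "finite X" using that assms finite_subset by auto
    ultimately obtain C'' where "(pebble_move l)\<^sup>*\<^sup>* C' C''" "orientation_of (digraph_of C'') G"
        "pebbles C' X < pebbles C'' X"
      using slide_along_path[of C' X p x G l] ne C' by blast
    then show False using max C' by (meson not_less rtranclp_trans)
  qed
  then show ?thesis using that C' peb by blast
qed

section \<open>Edges inside a reachable set, and building sparse graphs\<close>

lemma card_fibres:
  assumes "finite A" "finite R"
  shows "card {e \<in> A. t e \<in> R} = (\<Sum>v\<in>R. card {e \<in> A. t e = v})"
proof -
  have "{e \<in> A. t e \<in> R} = (\<Union>v\<in>R. {e \<in> A. t e = v})" by auto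
  moreover have "card \<dots> = (\<Sum>v\<in>R. card {e \<in> A. t e = v})"
    using assms by (intro card_UN_disjoint) auto
  ultimately show ?thesis by simp
qed

text \<open>Sum the invariant over \<open>R = reach ?D X\<close>. No arc leaves \<open>R\<close>, so
  its out-degrees count precisely the edges inside \<open>R\<close>, and all pebbles on
  \<open>R\<close> lie on \<open>X\<close>.\<close>

lemma collect_pebbles_card:
  assumes "multigraph G" "pebbled k (mverts G) C" "orientation_of (digraph_of C) G" "X \<subseteq> mverts G"
  obtains C' R where "(pebble_move l)\<^sup>*\<^sup>* C C'" "orientation_of (digraph_of C') G"
    "pebbled k (mverts G) C'" "X \<subseteq> R" "R \<subseteq> mverts G"
    "card {e \<in> medges G. set_uprod (mends G e) \<subseteq> R} + pebbles C' X = k * card R"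
proof -
  have fin: "finite (mverts G)" "finite (medges G)" using assms(1) unfolding multigraph_def by auto
  obtain C' where C': "(pebble_move l)\<^sup>*\<^sup>* C C'" "orientation_of (digraph_of C') G"
    "pebbled k (mverts G) C'"
    "\<And>x. x \<in> reach (digraph_of C') X - X \<Longrightarrow> on_vertex C' x = {#}"
    using collect_pebbles[OF assms(2-4) fin(1)] by blast
  let ?D = "digraph_of C'"
  define R where "R = reach ?D X"
  have arcs: "arcs ?D = medges G" "\<And>e. e \<in> medges G \<Longrightarrow> mends G e = Upair (tail ?D e) (head ?D e)"
    using C'(2) unfolding orientation_of_def by auto
  have heads: "head ?D e \<in> mverts G" if "e \<in> arcs ?D" for e
    using that arcs assms(1) unfolding multigraph_def by fastforce
  have R: "X \<subseteq> R" "R \<subseteq> mverts G"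
    unfolding R_def by (rule reach_superset, rule reach_subset[OF assms(4) heads])
  then have finR: "finite R" using fin finite_subset by auto
  have "set_uprod (mends G e) \<subseteq> R \<longleftrightarrow> tail ?D e \<in> R" if "e \<in> medges G" for e
    using that arcs reach_closed[of e ?D X] unfolding R_def by auto
  then have "{e \<in> medges G. set_uprod (mends G e) \<subseteq> R} = {e \<in> medges G. tail ?D e \<in> R}" by blast
  then have "card {e \<in> medges G. set_uprod (mends G e) \<subseteq> R} = (\<Sum>v\<in>R. out_degree ?D v)"
    using card_fibres[OF fin(2) finR] arcs(1) unfolding out_degree_def out_arcs_def by simp
  moreover have "pebbles C' X = pebbles C' R"
    using R finR C'(4) unfolding R_def by (intro sum.mono_neutral_left) auto
  moreover have "(\<Sum>v\<in>R. size (on_vertex C' v) + out_degree ?D v) = (\<Sum>v\<in>R. k)"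
    using C'(3) R(2) unfolding pebbled_def by (intro sum.cong) auto
  ultimately have "card {e \<in> medges G. set_uprod (mends G e) \<subseteq> R} + pebbles C' X = k * card R"
    by (simp add: sum.distrib mult.commute)
  then show ?thesis using that C' R by blast
qed

text \<open>Sparsity applied to the subgraph on \<open>X\<close> with edge set \<open>E\<close>.
  Letting \<open>E\<close> be only some of the edges inside \<open>X\<close> allows a partly built
  graph to be tested together with its next edge.\<close>

lemma sparse_induced_card:
  assumes "sparse k l G" "multigraph G" "X \<subseteq> mverts G"
    and E: "E \<subseteq> {e \<in> medges G. set_uprod (mends G e) \<subseteq> X}" "E \<noteq> {}"
  shows "card E + l \<le> k * card X"
proof -
  let ?H = "mgraph_on (mends G) X E"
  have fin: "finite X" "finite E"
    using assms(2,3) E finite_subset[of X "mverts G"] finite_subset[of E "medges G"]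
    unfolding multigraph_def by auto
  then have "msubgraph ?H G" using assms unfolding msubgraph_def multigraph_def by auto
  moreover have "card (medges ?H) \<ge> 1" using E fin by (simp add: Suc_leI card_gt_0_iff)
  ultimately have "int (card E) \<le> int k * int (card X) - int l"
    using assms(1) unfolding sparse_def by force
  then show ?thesis by (simp add: of_nat_mult[symmetric] del: of_nat_mult)
qed

lemma sparse_pebble_game_graph:
  fixes G :: "('v, 'e) mgraph"
  assumes G: "multigraph G" and sp: "sparse k l G"
  shows "pebble_game_graph k l G"
proof -
  have fin: "finite (mverts G)" "finite (medges G)" using G unfolding multigraph_def by auto
  have "\<exists>C\<^sub>0 C. initial_config k (mverts G) C\<^sub>0 \<and> (pebble_move l)\<^sup>*\<^sup>* C\<^sub>0 C \<and>
      orientation_of (digraph_of C) (mgraph_on (mends G) (mverts G) B)" if "B \<subseteq> medges G" for B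
    using finite_subset[OF that fin(2)] that
  proof induction
    case empty
    define C\<^sub>0 :: "('v, 'e) pebble_config" where
      "C\<^sub>0 = \<lparr> digraph_of = \<lparr> verts = mverts G, arcs = {}, tail = undefined, head = undefined \<rparr>,
        on_vertex = (\<lambda>_. mset_set {1..k}), on_edge = undefined \<rparr>"
    have "initial_config k (mverts G) C\<^sub>0" "(pebble_move l)\<^sup>*\<^sup>* C\<^sub>0 C\<^sub>0"
      "orientation_of (digraph_of C\<^sub>0) (mgraph_on (mends G) (mverts G) {})"
      unfolding C\<^sub>0_def initial_config_def orientation_of_def by auto
    then show ?case by blast
  next
    case (insert e B)
    let ?B = "mgraph_on (mends G) (mverts G) B"
    obtain C\<^sub>0 C where C: "initial_config k (mverts G) C\<^sub>0" "(pebble_move l)\<^sup>*\<^sup>* C\<^sub>0 C"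
        "orientation_of (digraph_of C) ?B"
      using insert by auto
    have B: "multigraph ?B"
      using G insert fin finite_subset[of B "medges G"] unfolding multigraph_def by auto
    obtain v w where vw: "mends G e = Upair v w" by (cases "mends G e") auto
    have "set_uprod (mends G e) \<subseteq> mverts G"
      using insert.prems G unfolding multigraph_def by auto
    then have sub: "{v, w} \<subseteq> mverts ?B" using vw by simp
    have peb: "pebbled k (mverts ?B) C"
      using reachable_pebbled[OF C(2) initial_pebbled[OF C(1)]] by simp
    obtain C' R where C': "(pebble_move l)\<^sup>*\<^sup>* C C'" "orientation_of (digraph_of C') ?B"
      "pebbled k (mverts ?B) C'" "{v, w} \<subseteq> R" "R \<subseteq> mverts ?B"
      and card: "card {f \<in> medges ?B. set_uprod (mends ?B f) \<subseteq> R} + pebbles C' {v, w} = k * card R"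
      by (rule collect_pebbles_card[OF B peb C(3) sub])
    let ?E = "{f \<in> B. set_uprod (mends G f) \<subseteq> R}"
    \<comment> \<open>Both ends of \<open>e\<close> lie in \<open>R\<close>, so sparsity may count
      \<open>e\<close> as well. This extra edge raises the guaranteed \<open>l\<close> pebbles to
      \<open>l + 1\<close>.\<close>
    have "card (insert e ?E) + l \<le> k * card R"
      using sp G C' vw insert.prems by (intro sparse_induced_card) auto
    moreover have "card (insert e ?E) = Suc (card ?E)" using insert.hyps by simp
    ultimately have many: "pebbles C' {v, w} \<ge> l + 1" using card by simp
    \<comment> \<open>The new arc starts at whichever end carries a pebble; its direction is
      immaterial for the underlying graph.\<close>
    obtain x y where xy: "{x, y} = {v, w}" "on_vertex C' x \<noteq> {#}"
    proof -
      have "on_vertex C' v \<noteq> {#} \<or> on_vertex C' w \<noteq> {#}"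
        using many by (cases "v = w") auto
      then show ?thesis using that[of v w] that[of w v] by (auto simp: insert_commute)
    qed
    obtain H P Q where C'_eq: "C' = \<lparr> digraph_of = H, on_vertex = P, on_edge = Q \<rparr>"
      by (cases C') auto
    obtain c where c: "c \<in># P x" using xy C'_eq by (auto simp: multiset_nonemptyE)
    define C'' where "C'' = \<lparr> digraph_of = H\<lparr> arcs := Set.insert e (arcs H),
        tail := (tail H)(e := x), head := (head H)(e := y) \<rparr>,
      on_vertex = P(x := P x - {#c#}), on_edge = Q(e := c) \<rparr>"
    have H: "verts H = mverts G" "arcs H = B" "\<forall>f\<in>B. mends G f = Upair (tail H f) (head H f)"
      using C'(2) C'_eq unfolding orientation_of_def by auto
    have move: "pebble_move l C' C''"
      unfolding C'_eq C''_def
    proof (rule add_edge)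
      show "x \<in> verts H" "y \<in> verts H" using H xy sub by auto
      show "e \<notin> arcs H" using H insert.hyps by simp
      show "l + 1 \<le> (\<Sum>u\<in>{x, y}. size (P u))" using many C'_eq unfolding xy(1) by simp
    qed (rule c)
    have "mends G e = Upair x y"
      using xy(1) vw by (auto simp: doubleton_eq_iff)
    then have "orientation_of (digraph_of C'') (mgraph_on (mends G) (mverts G) (Set.insert e B))"
      using H insert.hyps unfolding C''_def orientation_of_def by auto
    moreover have "(pebble_move l)\<^sup>*\<^sup>* C\<^sub>0 C''"
      using rtranclp_trans[OF C(2) C'(1)] move by (rule rtranclp.rtrancl_into_rtrancl)
    ultimately show ?case using C(1) by (intro exI conjI)
  qed
  from this[OF subset_refl] show ?thesis
    unfolding pebble_game_graph_def orientation_of_def by simp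
qed

subsection \<open>Disjoint branchings\<close>

text \<open>Leaving arcs are the relevant ones because the branchings point towards the
  root.\<close>

definition out_cut :: "('e \<Rightarrow> 'v) \<Rightarrow> ('e \<Rightarrow> 'v) \<Rightarrow> 'e set \<Rightarrow> 'v set \<Rightarrow> 'e set" where
  "out_cut t h A X = {e \<in> A. t e \<in> X \<and> h e \<notin> X}"

text \<open>The inequality already holds for the contribution of each single arc.\<close>

lemma out_cut_submodular:
  assumes "finite A"
  shows "card (out_cut t h A (X \<inter> Y)) + card (out_cut t h A (X \<union> Y)) \<le>
    card (out_cut t h A X) + card (out_cut t h A Y)"
proof -
  have card: "card (out_cut t h A Z) = (\<Sum>e\<in>A. if t e \<in> Z \<and> h e \<notin> Z then 1 else 0)" for Z
    using assms unfolding out_cut_def by (simp add: sum.If_cases Int_def)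
  show ?thesis unfolding card sum.distrib[symmetric] by (intro sum_mono) auto
qed

text \<open>The growth step in Lovasz's proof of Edmonds' disjoint branchings theorem: inside an
  inclusion-minimal set \<open>X\<close> that is critical for \<open>A - F\<close> and not covered by the tree, some arc
  leads from outside the tree into it, and by submodularity no critical set loses that arc.\<close>

lemma branching_growth:
  fixes t h :: "'e \<Rightarrow> 'v"
  assumes fin: "finite V" "finite A" and wf: "\<And>e. e \<in> A \<Longrightarrow> t e \<in> V \<and> h e \<in> V"
    and cuts: "\<And>X. X \<subseteq> V - {r} \<Longrightarrow> X \<noteq> {} \<Longrightarrow> Suc m \<le> card (out_cut t h A X)"
    and cutsF: "\<And>X. X \<subseteq> V - {r} \<Longrightarrow> X \<noteq> {} \<Longrightarrow> m \<le> card (out_cut t h (A - F) X)"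
    and T: "r \<in> T" "T \<subset> V" and tF: "\<And>e. e \<in> F \<Longrightarrow> t e \<in> T"
  shows "\<exists>e\<in>A - F. t e \<in> V - T \<and> h e \<in> T \<and>
    (\<forall>X. X \<subseteq> V - {r} \<and> X \<noteq> {} \<longrightarrow> m \<le> card (out_cut t h (A - insert e F) X))"
proof -
  define crit where "crit X \<longleftrightarrow> X \<subseteq> V - {r} \<and> X - T \<noteq> {} \<and> card (out_cut t h (A - F) X) = m" for X
  \<comment> \<open>Arcs of \<open>F\<close> have their tails in \<open>T\<close>, so removing them
    does not affect the arcs that leave a set disjoint from \<open>T\<close>.\<close>
  have outside: "out_cut t h (A - F) (X - T) = out_cut t h A (X - T)" for X
    using tF unfolding out_cut_def by auto
  have "\<exists>e\<in>A - F. t e \<in> V - T \<and> h e \<in> T \<and> (\<forall>Y. crit Y \<longrightarrow> t e \<in> Y \<longrightarrow> h e \<in> Y)"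
  proof (cases "\<exists>X. crit X")
    \<comment> \<open>Without critical sets any arc leaving \<open>V - T\<close> will do: its head
      is in \<open>V\<close>, hence in \<open>T\<close>.\<close>
    case False
    have "Suc m \<le> card (out_cut t h A (V - T))" using T by (intro cuts) auto
    then obtain e where "e \<in> out_cut t h A (V - T)" by fastforce
    then show ?thesis using False tF wf unfolding out_cut_def by blast
  next
    \<comment> \<open>Least cardinality is used to obtain inclusion-minimality.\<close>
    case True
    then obtain X where X: "crit X" and min: "\<And>Y. card Y < card X \<Longrightarrow> \<not> crit Y"
      using exists_least_iff[of "\<lambda>n. \<exists>X. crit X \<and> card X = n"] by metis
    have XV: "X \<subseteq> V - {r}" "X - T \<noteq> {}" "card (out_cut t h (A - F) X) = m"
      using X unfolding crit_def by auto
    have finX: "finite X" using XV(1) fin finite_subset by blast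
    \<comment> \<open>More arcs of \<open>A - F\<close> leave \<open>X - T\<close> than leave
      \<open>X\<close>, so one of them goes from \<open>X - T\<close> to
      \<open>X \<inter> T\<close>.\<close>
    have "Suc m \<le> card (out_cut t h A (X - T))" using XV by (intro cuts) auto
    then have "card (out_cut t h (A - F) X) < card (out_cut t h (A - F) (X - T))"
      using XV(3) outside by simp
    then have "\<not> out_cut t h (A - F) (X - T) \<subseteq> out_cut t h (A - F) X"
      using card_mono[of "out_cut t h (A - F) X" "out_cut t h (A - F) (X - T)"] fin
      unfolding out_cut_def by auto
    then obtain e where e: "e \<in> A - F" "t e \<in> X - T" "h e \<in> X" "h e \<in> T"
      unfolding out_cut_def by blast
    moreover have "h e \<in> Y" if Y: "crit Y" "t e \<in> Y" for Y
    proof (rule ccontr)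
      assume "h e \<notin> Y"
      have YV: "Y \<subseteq> V - {r}" "card (out_cut t h (A - F) Y) = m"
        using Y unfolding crit_def by auto
      \<comment> \<open>Both sets contain \<open>t e\<close> and are therefore nonempty.
        Submodularity makes both cuts equal to \<open>m\<close>, so \<open>X \<inter> Y\<close> is
        critical, yet it lacks \<open>h e\<close> and is smaller than \<open>X\<close>.\<close>
      have "m \<le> card (out_cut t h (A - F) (X \<inter> Y))" "m \<le> card (out_cut t h (A - F) (X \<union> Y))"
        using XV(1) YV(1) Y(2) e(2) by (intro cutsF; blast)+
      moreover have "card (out_cut t h (A - F) (X \<inter> Y)) + card (out_cut t h (A - F) (X \<union> Y)) \<le> m + m"
        using out_cut_submodular[of "A - F" t h X Y] fin(2) XV(3) YV(2) by simp
      ultimately have "crit (X \<inter> Y)" using XV(1) Y(2) e(2) unfolding crit_def by auto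
      moreover have "card (X \<inter> Y) < card X"
        using finX e(3) \<open>h e \<notin> Y\<close> by (intro psubset_card_mono) auto
      ultimately show False using min by blast
    qed
    ultimately show ?thesis using XV(1) by blast
  qed
  then obtain e where e: "e \<in> A - F" "t e \<in> V - T" "h e \<in> T"
    and safe: "\<And>Y. crit Y \<Longrightarrow> t e \<in> Y \<Longrightarrow> h e \<in> Y" by blast
  have "m \<le> card (out_cut t h (A - insert e F) X)" if X: "X \<subseteq> V - {r}" "X \<noteq> {}" for X
  proof (cases "t e \<in> X \<and> h e \<notin> X")
    case True
    \<comment> \<open>Here \<open>t e\<close> witnesses that \<open>X - T\<close> is nonempty, so
      not being critical means having an arc to spare.\<close>
    then have "\<not> crit X" using safe by blast
    then have "Suc m \<le> card (out_cut t h (A - F) X)"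
      using X True e cutsF[OF X] unfolding crit_def by (auto simp: le_less)
    moreover have "out_cut t h (A - insert e F) X = out_cut t h (A - F) X - {e}"
      unfolding out_cut_def by auto
    moreover have "e \<in> out_cut t h (A - F) X" using True e unfolding out_cut_def by auto
    ultimately show ?thesis by (simp add: card_Diff_singleton)
  next
    case False
    then have "out_cut t h (A - insert e F) X = out_cut t h (A - F) X"
      unfolding out_cut_def by auto
    then show ?thesis using cutsF[OF X] by simp
  qed
  then show ?thesis using e by blast
qed

text \<open>Starting from \<open>{r}\<close>, apply \<open>branching_growth\<close> until the tree
  covers \<open>V\<close>; each step preserves the bound \<open>m\<close> on the cuts that
  remain.\<close>

lemma spanning_branching:
  fixes t h :: "'e \<Rightarrow> 'v"
  assumes fin: "finite V" "finite A" and wf: "\<And>e. e \<in> A \<Longrightarrow> t e \<in> V \<and> h e \<in> V"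
    and ends: "\<And>e. e \<in> A \<Longrightarrow> ends e = Upair (t e) (h e)" and "r \<in> V"
    and cuts: "\<And>X. X \<subseteq> V - {r} \<Longrightarrow> X \<noteq> {} \<Longrightarrow> Suc m \<le> card (out_cut t h A X)"
  shows "\<exists>F\<subseteq>A. grown_tree ends r V F \<and> bij_betw t F (V - {r}) \<and>
    (\<forall>X. X \<subseteq> V - {r} \<and> X \<noteq> {} \<longrightarrow> m \<le> card (out_cut t h (A - F) X))"
proof -
  \<comment> \<open>The bijection says that \<open>F\<close> takes one arc out of every vertex of
    \<open>T\<close> except \<open>r\<close>, and none out of \<open>r\<close>.\<close>
  define Q where "Q T F \<longleftrightarrow> F \<subseteq> A \<and> grown_tree ends r T F \<and> bij_betw t F (T - {r}) \<and>
    (\<forall>X. X \<subseteq> V - {r} \<and> X \<noteq> {} \<longrightarrow> m \<le> card (out_cut t h (A - F) X))" for T F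
  have extend: "\<exists>F'. Q V F'" if "Q T F" "T \<subseteq> V" for T F
    using that
  proof (induction "card (V - T)" arbitrary: T F)
    case 0
    then have "T = V" using fin by auto
    then show ?case using 0 by blast
  next
    case (Suc n)
    have Q: "F \<subseteq> A" "grown_tree ends r T F" "bij_betw t F (T - {r})"
      "\<And>X. X \<subseteq> V - {r} \<Longrightarrow> X \<noteq> {} \<Longrightarrow> m \<le> card (out_cut t h (A - F) X)"
      using Suc.prems unfolding Q_def by auto
    have "r \<in> T" using grown_tree_basic[OF Q(2)] by blast
    moreover have "T \<subset> V" using Suc by auto
    moreover have "t e \<in> T" if "e \<in> F" for e using Q(3) that unfolding bij_betw_def by auto
    ultimately have "\<exists>e\<in>A - F. t e \<in> V - T \<and> h e \<in> T \<and>
        (\<forall>X. X \<subseteq> V - {r} \<and> X \<noteq> {} \<longrightarrow> m \<le> card (out_cut t h (A - insert e F) X))"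
      by (intro branching_growth[OF fin wf cuts Q(4)])
    then obtain e where e: "e \<in> A - F" "t e \<in> V - T" "h e \<in> T"
      "\<forall>X. X \<subseteq> V - {r} \<and> X \<noteq> {} \<longrightarrow> m \<le> card (out_cut t h (A - insert e F) X)"
      by (elim bexE conjE)
    have "grown_tree ends r (insert (t e) T) (insert e F)"
      using e ends by (intro grown_tree.leaf[OF Q(2), of "h e"]) auto
    moreover have "bij_betw t (insert e F) (insert (t e) T - {r})"
    proof -
      have "insert (t e) T - {r} = insert (t e) (T - {r})" using e \<open>r \<in> T\<close> by auto
      moreover have "t e \<notin> T - {r}" using e by auto
      ultimately show ?thesis using notIn_Un_bij_betw[of e F t "T - {r}"] e Q(3) by auto
    qed
    ultimately have "Q (insert (t e) T) (insert e F)" using Q(1) e unfolding Q_def by auto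
    moreover have "n = card (V - insert (t e) T)"
    proof -
      have "V - insert (t e) T = (V - T) - {t e}" by auto
      then show ?thesis using Suc.hyps(2) e(2) by (simp add: card_Diff_singleton)
    qed
    ultimately show ?case using Suc.hyps(1) Suc.prems(2) e(2) by blast
  qed
  have "Q {r} {}"
    using grown_tree.root cuts unfolding Q_def by (auto simp: bij_betw_def dest: Suc_leD)
  then show ?thesis using extend \<open>r \<in> V\<close> unfolding Q_def by blast
qed

text \<open>Edmonds' theorem, by peeling off one branching at a time at the cost of one in the cut
  bound. The last clause tracks out-degrees: each branching takes one arc at every vertex but the
  root. It is what lets the leftover arcs be split into map-graphs.\<close>

lemma disjoint_branchings:
  fixes t h :: "'e \<Rightarrow> 'v"
  assumes fin: "finite V" "finite A" and wf: "\<And>e. e \<in> A \<Longrightarrow> t e \<in> V \<and> h e \<in> V"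
    and ends: "\<And>e. e \<in> A \<Longrightarrow> ends e = Upair (t e) (h e)" and r: "r \<in> V"
    and cuts: "\<And>X. X \<subseteq> V - {r} \<Longrightarrow> X \<noteq> {} \<Longrightarrow> m \<le> card (out_cut t h A X)"
  shows "\<exists>F :: nat \<Rightarrow> 'e set. (\<forall>i<m. F i \<subseteq> A \<and> grown_tree ends r V (F i)) \<and>
    disjoint_family_on F {..<m} \<and>
    (\<forall>v\<in>V. card {e \<in> A - (\<Union>i<m. F i). t e = v} + (if v = r then 0 else m) = card {e \<in> A. t e = v})"
  using fin(2) wf ends cuts
proof (induction m arbitrary: A)
  case 0
  then show ?case by (simp add: disjoint_family_on_def)
next
  case (Suc m)
  obtain F\<^sub>m where F\<^sub>m: "F\<^sub>m \<subseteq> A" "grown_tree ends r V F\<^sub>m" "bij_betw t F\<^sub>m (V - {r})"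
    "\<forall>X. X \<subseteq> V - {r} \<and> X \<noteq> {} \<longrightarrow> m \<le> card (out_cut t h (A - F\<^sub>m) X)"
    using spanning_branching[OF fin(1) Suc.prems(1,2,3) r Suc.prems(4)] by blast
  obtain F :: "nat \<Rightarrow> 'e set" where F: "\<forall>i<m. F i \<subseteq> A - F\<^sub>m \<and> grown_tree ends r V (F i)"
    "disjoint_family_on F {..<m}"
    "\<forall>v\<in>V. card {e \<in> A - F\<^sub>m - (\<Union>i<m. F i). t e = v} + (if v = r then 0 else m) =
      card {e \<in> A - F\<^sub>m. t e = v}"
    using Suc.IH[of "A - F\<^sub>m"] Suc.prems F\<^sub>m(4) by auto
  have fibre: "card {e \<in> A - F\<^sub>m. t e = v} + (if v = r then 0 else 1) = card {e \<in> A. t e = v}"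
    if "v \<in> V" for v
  proof (cases "v = r")
    case True
    then have "{e \<in> A - F\<^sub>m. t e = v} = {e \<in> A. t e = v}"
      using F\<^sub>m(3) unfolding bij_betw_def by auto
    then show ?thesis using True by simp
  next
    case False
    then have "v \<in> t ` F\<^sub>m" using F\<^sub>m(3) that by (simp add: bij_betw_def)
    then obtain e where e: "e \<in> F\<^sub>m" "t e = v" by blast
    have "f = e" if "f \<in> F\<^sub>m" "t f = v" for f
      using bij_betw_imp_inj_on[OF F\<^sub>m(3)] e that by (simp add: inj_on_def)
    then have "{f \<in> A - F\<^sub>m. t f = v} = {f \<in> A. t f = v} - {e}"
      using e by blast
    moreover have "e \<in> A" using e(1) F\<^sub>m(1) by blast
    ultimately show ?thesis
      using card_fibre_remove[OF Suc.prems(1), of e t v] e(2) False by simp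
  qed
  define F' where "F' = F(m := F\<^sub>m)"
  have un: "(\<Union>i<Suc m. F' i) = F\<^sub>m \<union> (\<Union>i<m. F i)"
    unfolding F'_def by (auto simp: less_Suc_eq)
  have diff: "A - (F\<^sub>m \<union> (\<Union>i<m. F i)) = A - F\<^sub>m - (\<Union>i<m. F i)" by auto
  have "\<forall>i<Suc m. F' i \<subseteq> A \<and> grown_tree ends r V (F' i)"
    using F(1) F\<^sub>m unfolding F'_def by (auto simp: less_Suc_eq)
  moreover have "disjoint_family_on F' {..<Suc m}"
    unfolding disjoint_family_on_def
  proof (intro ballI impI)
    fix i j assume ij: "i \<in> {..<Suc m}" "j \<in> {..<Suc m}" "i \<noteq> j"
    then consider "i < m" "j < m" | "i < m" "j = m" | "i = m" "j < m" by fastforce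
    then show "F' i \<inter> F' j = {}"
    proof cases
      case 1
      then show ?thesis using F(2) ij unfolding F'_def disjoint_family_on_def by simp
    qed (use F(1) in \<open>auto simp: F'_def\<close>)
  qed
  moreover have "\<forall>v\<in>V. card {e \<in> A - (\<Union>i<Suc m. F' i). t e = v} + (if v = r then 0 else Suc m) =
      card {e \<in> A. t e = v}"
    unfolding un diff
  proof
    fix v assume "v \<in> V"
    then show "card {e \<in> A - F\<^sub>m - (\<Union>i<m. F i). t e = v} + (if v = r then 0 else Suc m) =
        card {e \<in> A. t e = v}"
      using bspec[OF F(3), of v] fibre[of v] by (cases "v = r") auto
  qed
  ultimately show ?case by blast
qed

subsection \<open>Decomposing tight graphs\<close>

text \<open>Sparsity puts at least \<open>l\<close> pebbles on \<open>r\<close> and tightness leaves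
  exactly \<open>l\<close> in total, so every other vertex is empty. The invariant then yields the
  out-degrees.\<close>

lemma tight_pebble_game_orientation:
  assumes G: "multigraph G" and "l \<le> k" "pebble_game_graph k l G" "tight k l G" and r: "r \<in> mverts G"
  obtains D where "orientation_of D G"
    "\<And>v. v \<in> mverts G \<Longrightarrow> out_degree D v = (if v = r then k - l else k)"
proof -
  have fin: "finite (mverts G)" "finite (medges G)" using G unfolding multigraph_def by auto
  obtain C\<^sub>0 C where C: "initial_config k (mverts G) C\<^sub>0" "(pebble_move l)\<^sup>*\<^sup>* C\<^sub>0 C"
      "orientation_of (digraph_of C) G"
    using assms unfolding pebble_game_graph_def by blast
  then have peb: "pebbled k (mverts G) C" using reachable_pebbled initial_pebbled by blast
  have "{r} \<subseteq> mverts G" using r by simp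
  then obtain C' R where C': "(pebble_move l)\<^sup>*\<^sup>* C C'" "orientation_of (digraph_of C') G"
    "pebbled k (mverts G) C'" "{r} \<subseteq> R" "R \<subseteq> mverts G"
    and card: "card {e \<in> medges G. set_uprod (mends G e) \<subseteq> R} + pebbles C' {r} = k * card R"
    by (rule collect_pebbles_card[OF G peb C(3)])
  let ?D = "digraph_of C'" and ?E = "{e \<in> medges G. set_uprod (mends G e) \<subseteq> R}"
  have deg: "size (on_vertex C' v) + out_degree ?D v = k" if "v \<in> mverts G" for v
    using C'(3) that unfolding pebbled_def by blast
  have "l \<le> size (on_vertex C' r)"
  proof (cases "?E = {}")
    \<comment> \<open>Sparsity says nothing about an empty edge set; here \<open>r\<close> holds
      \<open>k * card R\<close> pebbles, which is at least \<open>k\<close> and hence at least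
      \<open>l\<close>.\<close>
    case True
    then have "size (on_vertex C' r) = k * card R" using card unfolding True by simp
    moreover have "card R > 0" using C' fin finite_subset by (auto simp: card_gt_0_iff)
    ultimately show ?thesis using \<open>l \<le> k\<close> by (cases "card R") auto
  next
    case False
    then have "card ?E + l \<le> k * card R"
      using assms C'(5) unfolding tight_def by (intro sparse_induced_card) auto
    then show ?thesis using card by simp
  qed
  \<comment> \<open>The invariant summed over all vertices: the free pebbles number
    \<open>k * n\<close> minus the number of edges.\<close>
  moreover have "pebbles C' (mverts G) = l"
  proof -
    have "(\<Sum>v\<in>mverts G. out_degree ?D v) = card {e \<in> medges G. tail ?D e \<in> mverts G}"
      using card_fibres[OF fin(2,1)] C'(2)
      unfolding orientation_of_def out_degree_def out_arcs_def by simp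
    moreover have "{e \<in> medges G. tail ?D e \<in> mverts G} = medges G"
      using G C'(2) unfolding multigraph_def orientation_of_def by fastforce
    moreover have "(\<Sum>v\<in>mverts G. size (on_vertex C' v) + out_degree ?D v) = (\<Sum>v\<in>mverts G. k)"
      using deg by (intro sum.cong) auto
    ultimately have "pebbles C' (mverts G) + card (medges G) = k * card (mverts G)"
      by (simp add: sum.distrib mult.commute)
    moreover have "int (card (medges G)) + int l = int k * int (card (mverts G))"
      using \<open>tight k l G\<close> unfolding tight_def by simp
    then have "card (medges G) + l = k * card (mverts G)"
      by (metis of_nat_add of_nat_eq_iff of_nat_mult)
    ultimately show ?thesis by simp
  qed
  moreover have "pebbles C' (mverts G) = size (on_vertex C' r) + pebbles C' (mverts G - {r})"
    using fin r by (simp add: sum.remove)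
  ultimately have "size (on_vertex C' r) = l" "pebbles C' (mverts G - {r}) = 0" by auto
  then have "size (on_vertex C' v) = (if v = r then l else 0)" if "v \<in> mverts G" for v
    using that fin by auto
  then have "out_degree ?D v = (if v = r then k - l else k)" if "v \<in> mverts G" for v
    using deg[OF that] that by (auto split: if_splits)
  then show ?thesis using that C'(2) by blast
qed

lemma oriented_maps_and_trees:
  fixes G :: "('v, 'e) mgraph"
  assumes G: "multigraph G" and "l \<le> k" "sparse k l G" and r: "r \<in> mverts G"
    and D: "orientation_of D G" "\<And>v. v \<in> mverts G \<Longrightarrow> out_degree D v = (if v = r then k - l else k)"
  shows "maps_and_trees k l G"
proof -
  let ?V = "mverts G" and ?A = "medges G" and ?t = "tail D" and ?h = "head D"
  have fin: "finite ?V" "finite ?A" using G unfolding multigraph_def by auto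
  have ends: "mends G e = Upair (?t e) (?h e)" if "e \<in> ?A" for e
    using D(1) that unfolding orientation_of_def by auto
  have wf: "?t e \<in> ?V \<and> ?h e \<in> ?V" if "e \<in> ?A" for e
    using G ends[OF that] that unfolding multigraph_def by auto
  have deg: "card {e \<in> ?A. ?t e = v} = (if v = r then k - l else k)" if "v \<in> ?V" for v
    using D(1) D(2)[OF that] unfolding orientation_of_def out_degree_def out_arcs_def by simp
  \<comment> \<open>Exactly \<open>k * card X\<close> arcs start in \<open>X\<close>, since
    \<open>r\<close> is not in \<open>X\<close>, and sparsity allows at most
    \<open>k * card X - l\<close> of them to stay inside.\<close>
  have cuts: "l \<le> card (out_cut ?t ?h ?A X)" if X: "X \<subseteq> ?V - {r}" "X \<noteq> {}" for X
  proof -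
    let ?E = "{e \<in> ?A. set_uprod (mends G e) \<subseteq> X}"
    have finX: "finite X" using X fin finite_subset by blast
    have "{e \<in> ?A. ?t e \<in> X} = ?E \<union> out_cut ?t ?h ?A X" "?E \<inter> out_cut ?t ?h ?A X = {}"
      using ends unfolding out_cut_def by auto
    then have "card {e \<in> ?A. ?t e \<in> X} = card ?E + card (out_cut ?t ?h ?A X)"
      using fin by (simp add: card_Un_disjoint out_cut_def)
    moreover have "card {e \<in> ?A. ?t e \<in> X} = (\<Sum>v\<in>X. k)"
      unfolding card_fibres[OF fin(2) finX]
    proof (rule sum.cong)
      fix v assume "v \<in> X"
      then have "v \<in> ?V" "v \<noteq> r" using X by auto
      then show "card {e \<in> ?A. ?t e = v} = k" using deg by simp
    qed simp
    ultimately have sum: "card ?E + card (out_cut ?t ?h ?A X) = k * card X"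
      by (simp add: mult.commute)
    show ?thesis
    proof (cases "?E = {}")
      case True
      have "card X \<ge> 1" using X finX by (simp add: Suc_leI card_gt_0_iff)
      then have "k \<le> k * card X" by simp
      moreover have "card ?E = 0" unfolding True by simp
      ultimately show ?thesis using sum \<open>l \<le> k\<close> by linarith
    next
      case False
      then have "card ?E + l \<le> k * card X"
        using assms(3) G X by (intro sparse_induced_card) auto
      then show ?thesis using sum by simp
    qed
  qed
  have "\<exists>F :: nat \<Rightarrow> 'e set. (\<forall>i<l. F i \<subseteq> ?A \<and> grown_tree (mends G) r ?V (F i)) \<and>
    disjoint_family_on F {..<l} \<and>
    (\<forall>v\<in>?V. card {e \<in> ?A - (\<Union>i<l. F i). ?t e = v} + (if v = r then 0 else l) =
      card {e \<in> ?A. ?t e = v})"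
    by (rule disjoint_branchings[OF fin wf ends r cuts])
  then obtain F :: "nat \<Rightarrow> 'e set" where
    F: "\<forall>i<l. F i \<subseteq> ?A \<and> grown_tree (mends G) r ?V (F i)" "disjoint_family_on F {..<l}"
    "\<forall>v\<in>?V. card {e \<in> ?A - (\<Union>i<l. F i). ?t e = v} + (if v = r then 0 else l) =
      card {e \<in> ?A. ?t e = v}"
    by (elim exE conjE)
  define B where "B = ?A - (\<Union>i<l. F i)"
  \<comment> \<open>Without the trees, \<open>k - l\<close> arcs start at every vertex:
    \<open>r\<close> has lost none, every other vertex has lost \<open>l\<close> of its
    \<open>k\<close>. They are numbered by the indices of the map-graphs.\<close>
  have "\<exists>g. bij_betw g {e \<in> B. ?t e = v} {l..<k}" if "v \<in> ?V" for v
  proof (rule finite_same_card_bij)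
    show "finite {e \<in> B. ?t e = v}" using fin unfolding B_def by auto
    show "card {e \<in> B. ?t e = v} = card {l..<k}"
      using F(3) deg[OF that] that \<open>l \<le> k\<close> unfolding B_def by (auto split: if_splits)
  qed simp
  then obtain g where g: "\<And>v. v \<in> ?V \<Longrightarrow> bij_betw (g v) {e \<in> B. ?t e = v} {l..<k}" by metis
  define col where "col e = g (?t e) e" for e
  have col: "col e \<in> {l..<k}" if "e \<in> B" for e
    using bij_betwE[OF g, of "?t e"] that wf unfolding B_def col_def by blast
  \<comment> \<open>Each number occurs on exactly one arc out of each vertex, so each number class
    is a map-graph oriented by \<open>D\<close>.\<close>
  have unique: "\<exists>e. {e \<in> B. ?t e = v \<and> col e = i} = {e}" if "v \<in> ?V" "i \<in> {l..<k}" for v i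
  proof -
    have "i \<in> g v ` {e \<in> B. ?t e = v}" using g[OF that(1)] that(2) by (simp add: bij_betw_def)
    then obtain e where e: "e \<in> B" "?t e = v" "g v e = i" by blast
    have "f = e" if "f \<in> B" "?t f = v" "g v f = i" for f
      using bij_betw_imp_inj_on[OF g[OF \<open>v \<in> ?V\<close>]] e that by (simp add: inj_on_def)
    then have "{e \<in> B. ?t e = v \<and> g v e = i} = {e}" using e by blast
    moreover have "{e \<in> B. ?t e = v \<and> col e = i} = {e \<in> B. ?t e = v \<and> g v e = i}"
      unfolding col_def by auto
    ultimately show ?thesis by (intro exI[of _ e]) simp
  qed
  define E where "E i = (if i < l then F i else {e \<in> B. col e = i})" for i
  define S where "S i = mgraph_on (mends G) ?V (E i)" for i
  have E_sub: "E i \<subseteq> ?A" for i using F(1) unfolding E_def B_def by auto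
  show ?thesis unfolding maps_and_trees_def
  proof (intro exI[of _ S] conjI allI impI ballI)
    fix i
    show "spanning_msubgraph (S i) G"
      using E_sub[of i] G finite_subset[OF E_sub fin(2)]
      unfolding spanning_msubgraph_def msubgraph_def multigraph_def S_def by auto
  next
    show "disjoint_family_on (\<lambda>i. medges (S i)) {..<k}"
      using F(2) unfolding S_def E_def B_def disjoint_family_on_def by auto
  next
    show "(\<Union>i<k. medges (S i)) = ?A"
    proof
      show "(\<Union>i<k. medges (S i)) \<subseteq> ?A" using E_sub unfolding S_def by auto
      show "?A \<subseteq> (\<Union>i<k. medges (S i))"
      proof
        fix e assume e: "e \<in> ?A"
        show "e \<in> (\<Union>i<k. medges (S i))"
        proof (cases "e \<in> B")
          case True
          then have "e \<in> medges (S (col e))" "col e < k" using col[of e] unfolding S_def E_def by auto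
          then show ?thesis by blast
        next
          case False
          then obtain i where "i < l" "e \<in> F i" using e unfolding B_def by auto
          then have "e \<in> medges (S i)" "i < k" using \<open>l \<le> k\<close> unfolding S_def E_def by auto
          then show ?thesis by blast
        qed
      qed
    qed
  next
    fix i assume "i < l"
    then have "grown_tree (mends G) r ?V (E i)" using F(1) unfolding E_def by simp
    then show "mtree (S i)" unfolding S_def by (rule grown_tree_mtree)
  next
    fix i assume i: "i \<in> {l..<k}"
    let ?D = "\<lparr> verts = ?V, arcs = E i, tail = ?t, head = ?h \<rparr>"
    have "orientation_of ?D (S i)" using ends E_sub unfolding orientation_of_def S_def by auto
    moreover have "out_degree ?D v = 1" if "v \<in> ?V" for v
    proof -
      have "out_arcs ?D v = {e \<in> B. ?t e = v \<and> col e = i}"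
        using i unfolding out_arcs_def E_def by auto
      then show ?thesis using unique[OF that i] unfolding out_degree_def by auto
    qed
    ultimately show "map_graph (S i)" unfolding map_graph_def by (intro exI[of _ ?D]) simp
  qed
qed

theorem theorem3:
  fixes G :: "('v, 'e) mgraph" and k l :: nat
  assumes "multigraph G" and "l \<le> k"
  shows "pebble_game_graph k l G \<and> tight k l G \<longleftrightarrow> maps_and_trees k l G"
proof
  assume "maps_and_trees k l G"
  then have "tight k l G" using maps_and_trees_tight assms by blast
  then show "pebble_game_graph k l G \<and> tight k l G"
    using sparse_pebble_game_graph assms(1) unfolding tight_def by blast
next
  assume G: "pebble_game_graph k l G \<and> tight k l G"
  show "maps_and_trees k l G"
  proof (cases "mverts G = {}")
    case False
    then obtain r where r: "r \<in> mverts G" by blast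
    obtain D where "orientation_of D G"
      "\<And>v. v \<in> mverts G \<Longrightarrow> out_degree D v = (if v = r then k - l else k)"
      using tight_pebble_game_orientation[OF assms _ _ r] G by blast
    then show ?thesis using oriented_maps_and_trees[OF assms _ r] G unfolding tight_def by blast
  next
    \<comment> \<open>There is no root to choose. Tightness forces \<open>l = 0\<close>, so all
      parts must be map-graphs, and the edgeless \<open>G\<close> itself serves for each: its
      out-degree condition is vacuous.\<close>
    case True
    have edges: "medges G = {}" and "l = 0"
    proof -
      have "set_uprod (mends G e) \<noteq> {}" for e by (cases "mends G e") auto
      then show "medges G = {}" using assms(1) True unfolding multigraph_def by auto
      then show "l = 0" using G True unfolding tight_def by simp
    qed
    have "map_graph G"
      using G True unfolding pebble_game_graph_def map_graph_def orientation_of_def by blast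
    moreover have "spanning_msubgraph G G"
      using assms(1) unfolding spanning_msubgraph_def msubgraph_def by simp
    ultimately show ?thesis
      using edges \<open>l = 0\<close> unfolding maps_and_trees_def disjoint_family_on_def
      by (intro exI[of _ "\<lambda>_. G"]) auto
  qed
qed

end
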